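(* Let $\{Z(t),t\ge 0\}$ be a critical Markov branching process with infinitesimal generating function $f$, let $0<\nu<1$, and suppose that $f(1-y)=y\Lambda(y)$ for all $y\in(0,1]$, where $\Lambda(y)=y^{\nu}\mathcal{L}(1/y)$ with $\mathcal{L}$ slowly varying at infinity, and that $\dfrac{y\Lambda'(y)}{\Lambda(y)}=\nu+\delta(y)$, where $\delta$ is continuous and $\delta(y)\to 0$ as $y\downarrow 0$. Let $F(t;s)=\mathbb{E}[s^{Z(t)}\mid Z(0)=1]$ and $R(t;s)=1-F(t;s)$. Then for all $s\in[0,1)$ and $t\ge0$ $$\frac{1}{\Lambda(R(t;s))}-\frac{1}{\Lambda(1-s)}=\nu t+\int_0^t\delta(R(u;s))\,du .$$ If in addition $\delta(y)=\Lambda(y)$ for all $y\in(0,1]$, then for $s\in[0,1)$ $$\frac{1}{\Lambda(R(t;s))}-\frac{1}{\Lambda(1-s)}=\nu t+\frac{1}{\nu}\ln\nu(t;s)+o\bigl(\ln\nu(t;s)\bigr)\qquad\text{as } t\to\infty,$$ where $\nu(t;s)=\Lambda(1-s)\,\nu t+1$.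
   Context: A Markov branching process (MBP) is a homogeneous continuous-time Markov process $\{Z(t),t\ge0\}$ with state space $\mathcal{S}_0=\{0\}\cup\mathcal{S}$, $\mathcal{S}\subset\mathbb{N}=\{1,2,\dots\}$, whose transition probabilities $P_{ij}(t)=\mathbb{P}\{Z(t)=j\mid Z(0)=i\}$ satisfy the branching property $P_{ij}(t)=P_{1j}^{i*}(t)$ ($i$-fold convolution) and $P_{1j}(\varepsilon)=\delta_{1j}+a_j\varepsilon+o(\varepsilon)$ as $\varepsilon\downarrow0$ ($\delta_{1j}$ is Kronecker's delta), where $a_j\ge0$ for $j\ne1$ and $0<a_0<-a_1=\sum_{j\in\mathcal{S}_0\setminus\{1\}}a_j<\infty$. Its infinitesimal generating function is $f(s)=\sum_{j\in\mathcal{S}_0}a_js^j$, $s\in[0,1)$. The generating function $F(t;s)=\sum_{j\in\mathcal{S}_0}P_{1j}(t)s^j$ is the unique solution of $\partial F/\partial t=f(F)$, $F(0;s)=s$. The process is critical if $f'(1-)=\sum_{j\in\mathcal S}ja_j=0$. A positive function $\mathcal{L}$ is slowly varying at infinity (in the sense of Karamata) if $\mathcal{L}(\lambda x)/\mathcal{L}(x)\to1$ as $x\to\infty$ for every $\lambda>0$. In $\nu(t;s)$ the symbol $\nu(\cdot;\cdot)$ denotes a function of two variables, while $\nu$ alone denotes the constant in $(0,1)$. *)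

theory Defs
  imports
    "HOL-Probability.Probability"
    "HOL-Library.Landau_Symbols"
    "HOL-Computational_Algebra.Formal_Power_Series"
begin

text \<open>
  The conditional law of the process given \<open>Z(0) = i\<close> is the member \<open>Pr i\<close> of a family of
  probability measures on one measurable space.
\<close>

definition trans_prob ::
  "(nat \<Rightarrow> 'w measure) \<Rightarrow> (real \<Rightarrow> 'w \<Rightarrow> nat) \<Rightarrow> nat \<Rightarrow> nat \<Rightarrow> real \<Rightarrow> real" where
  "trans_prob Pr Z i j t = \<P>(\<omega> in Pr i. Z t \<omega> = j)"

locale homogeneous_markov_process =
  fixes E :: "nat set"
    and Pr :: "nat \<Rightarrow> 'w measure"
    and Z :: "real \<Rightarrow> 'w \<Rightarrow> nat"
  assumes prob_space_law: "\<And>i. i \<in> E \<Longrightarrow> prob_space (Pr i)"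
    and sets_law: "\<And>i j. i \<in> E \<Longrightarrow> j \<in> E \<Longrightarrow> sets (Pr i) = sets (Pr j)"
    and measurable_state: "\<And>i t. i \<in> E \<Longrightarrow> 0 \<le> t \<Longrightarrow> Z t \<in> Pr i \<rightarrow>\<^sub>M count_space E"
    and initial_state: "\<And>i. i \<in> E \<Longrightarrow> AE \<omega> in Pr i. Z 0 \<omega> = i"
    and markov_property:
      "\<And>i j n ts x h.
         i \<in> E \<Longrightarrow> j \<in> E \<Longrightarrow> 0 \<le> ts 0 \<Longrightarrow> strict_mono_on {..n::nat} ts \<Longrightarrow> 0 \<le> h \<Longrightarrow>
         \<P>(\<omega> in Pr i. \<forall>k\<le>n. Z (ts k) \<omega> = x k) > 0 \<Longrightarrow>
         \<P>(\<omega> in Pr i. Z (ts n + h) \<omega> = j \<bar> \<forall>k\<le>n. Z (ts k) \<omega> = x k)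
           = trans_prob Pr Z (x n) j h"

text \<open>
  Multiplication of formal power series is convolution of coefficient sequences, so the
  \<open>i\<close>-fold convolution of a sequence is the coefficient sequence of the \<open>i\<close>-th power.
\<close>

definition conv_power :: "(nat \<Rightarrow> real) \<Rightarrow> nat \<Rightarrow> nat \<Rightarrow> real" where
  "conv_power p i j = fps_nth (Abs_fps p ^ i) j"

text \<open>
  The full state space is \<open>insert 0 S\<close>; the values \<open>a j\<close> for \<open>j\<close> outside of it are irrelevant.
\<close>

locale markov_branching_process =
  homogeneous_markov_process "insert 0 S" Pr Z
  for S :: "nat set" and Pr :: "nat \<Rightarrow> 'w measure" and Z :: "real \<Rightarrow> 'w \<Rightarrow> nat" +
  fixes a :: "nat \<Rightarrow> real"
  assumes zero_notin_S: "0 \<notin> S"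
    and one_in_S: "1 \<in> S"
    and branching:
      "\<And>i j t. i \<in> insert 0 S \<Longrightarrow> j \<in> insert 0 S \<Longrightarrow> 0 \<le> t \<Longrightarrow>
         trans_prob Pr Z i j t = conv_power (\<lambda>k. trans_prob Pr Z 1 k t) i j"
    and infinitesimal:
      "\<And>j. j \<in> insert 0 S \<Longrightarrow>
         (\<lambda>\<epsilon>. trans_prob Pr Z 1 j \<epsilon> - (of_bool (j = 1) + a j * \<epsilon>)) \<in> o[at_right 0](\<lambda>\<epsilon>. \<epsilon>)"
    and rates_nonneg: "\<And>j. j \<in> insert 0 S \<Longrightarrow> j \<noteq> 1 \<Longrightarrow> 0 \<le> a j"
    and rate_0_pos: "0 < a 0"
    and rate_0_less: "a 0 < - a 1"
    and rates_sum: "(a has_sum (- a 1)) (insert 0 S - {1})"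

definition inf_gf :: "nat set \<Rightarrow> (nat \<Rightarrow> real) \<Rightarrow> real \<Rightarrow> real" where
  "inf_gf S a s = (\<Sum>\<^sub>\<infinity>j\<in>insert 0 S. a j * s ^ j)"

text \<open>Criticality is \<open>f'(1-) = (\<Sum>j\<in>S. j * a j) = 0\<close>.\<close>

locale critical_markov_branching_process =
  markov_branching_process S Pr Z a
  for S :: "nat set" and Pr :: "nat \<Rightarrow> 'w measure" and Z :: "real \<Rightarrow> 'w \<Rightarrow> nat"
    and a :: "nat \<Rightarrow> real" +
  assumes critical: "((\<lambda>j. real j * a j) has_sum 0) S"

definition gen_fun ::
  "(nat \<Rightarrow> 'w measure) \<Rightarrow> (real \<Rightarrow> 'w \<Rightarrow> nat) \<Rightarrow> real \<Rightarrow> real \<Rightarrow> real" where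
  "gen_fun Pr Z t s = (\<integral>\<omega>. s ^ Z t \<omega> \<partial>Pr 1)"

definition gen_fun_compl ::
  "(nat \<Rightarrow> 'w measure) \<Rightarrow> (real \<Rightarrow> 'w \<Rightarrow> nat) \<Rightarrow> real \<Rightarrow> real \<Rightarrow> real" where
  "gen_fun_compl Pr Z t s = 1 - gen_fun Pr Z t s"

definition slowly_varying :: "(real \<Rightarrow> real) \<Rightarrow> bool" where
  "slowly_varying L \<longleftrightarrow>
     (\<forall>x>0. 0 < L x) \<and> (\<forall>c>0. ((\<lambda>x. L (c * x) / L x) \<longlongrightarrow> 1) at_top)"

end

theory Submission
  imports Defs
begin

text \<open>
  The Markov and branching properties give \<open>F(t + h; s) = F(h; F(t; s))\<close>, and the assumption on
  \<open>P\<^sub>1\<^sub>j(\<epsilon>)\<close> gives \<open>F(h; x) = x + h f(x) + o(h)\<close> uniformly for \<open>x\<close> in a compact part of \<open>[0, 1)\<close>.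
  Together they yield the backward equation \<open>\<partial>F/\<partial>t = f(F)\<close>, that is \<open>\<partial>R/\<partial>t = - R \<Lambda>(R)\<close>. Hence
  \<open>1 / \<Lambda>(R)\<close> has derivative \<open>R \<Lambda>'(R) / \<Lambda>(R) = \<nu> + \<delta>(R)\<close>, which integrates to the first formula.
  If \<open>\<delta> = \<Lambda>\<close>, then \<open>G = 1 / \<Lambda>(R)\<close> solves \<open>G' = \<nu> + 1 / G\<close>. Comparing \<open>G\<close> with the linear function
  \<open>x(t) = G(0) + \<nu> t\<close> shows first \<open>G \<ge> x\<close>, then \<open>G \<le> x + ln (x / G(0)) / \<nu>\<close>, and feeding the latter
  back into the equation shows that the error is even bounded, by \<open>1 / (\<nu>\<^sup>2 G(0))\<close>.
\<close>

section \<open>Expectations split over a discrete variable, and powers of power series\<close>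

text \<open>The \<open>n\<close>-th partial sum is the integral of \<open>f\<close> over
  \<open>X < n\<close>; the integrands are dominated by \<open>\<bar>f\<bar>\<close>, so dominated
  convergence gives the limit.\<close>

lemma (in finite_measure) integral_partition_nat_sums:
  fixes f :: "'a \<Rightarrow> real" and X :: "'a \<Rightarrow> nat"
  assumes f: "integrable M f" and X: "X \<in> M \<rightarrow>\<^sub>M count_space UNIV"
  shows "(\<lambda>k. \<integral>\<omega>. f \<omega> * of_bool (X \<omega> = k) \<partial>M) sums (\<integral>\<omega>. f \<omega> \<partial>M)"
proof -
  note [measurable] = X borel_measurable_integrable[OF f]
  have int: "integrable M (\<lambda>\<omega>. f \<omega> * of_bool (X \<omega> = k))" for k
    by (rule Bochner_Integration.integrable_bound[OF f]) auto
  have part: "(\<Sum>k<n. f \<omega> * of_bool (X \<omega> = k)) = f \<omega> * of_bool (X \<omega> < n)" for n \<omega>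
    by (induction n) (auto simp: less_Suc_eq)
  have "(\<lambda>n. \<integral>\<omega>. f \<omega> * of_bool (X \<omega> < n) \<partial>M) \<longlonglongrightarrow> (\<integral>\<omega>. f \<omega> \<partial>M)"
  proof (rule integral_dominated_convergence[where w = "\<lambda>\<omega>. \<bar>f \<omega>\<bar>"])
    show "AE \<omega> in M. (\<lambda>n. f \<omega> * of_bool (X \<omega> < n)) \<longlonglongrightarrow> f \<omega>"
    proof (rule AE_I2)
      fix \<omega>
      have "\<forall>\<^sub>F n in sequentially. f \<omega> * of_bool (X \<omega> < n) = f \<omega>"
        using eventually_gt_at_top[of "X \<omega>"] by eventually_elim simp
      then show "(\<lambda>n. f \<omega> * of_bool (X \<omega> < n)) \<longlonglongrightarrow> f \<omega>"
        by (rule tendsto_eventually)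
    qed
  qed (use f in auto)
  then show ?thesis
    unfolding sums_def by (simp add: part flip: Bochner_Integration.integral_sum[OF int])
qed

text \<open>Induction on \<open>i\<close> with the Cauchy product of series. Nonnegativity of the
  coefficients is carried along because it turns convergence into the absolute convergence that the
  product needs.\<close>

lemma conv_power_sums:
  fixes p :: "nat \<Rightarrow> real"
  assumes p: "\<And>k. 0 \<le> p k" and s: "0 \<le> s" and sums: "(\<lambda>k. p k * s ^ k) sums F"
  shows "0 \<le> conv_power p i j" and "(\<lambda>j. conv_power p i j * s ^ j) sums F ^ i"
proof -
  have "(\<forall>j. 0 \<le> conv_power p i j) \<and> (\<lambda>j. conv_power p i j * s ^ j) sums F ^ i"
  proof (induction i)
    case 0
    have "(\<lambda>j. conv_power p 0 j * s ^ j) = (\<lambda>j. if j = 0 then 1 else 0)"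
      by (auto simp: conv_power_def)
    then show ?case
      using sums_single[of 0 "\<lambda>_. 1::real"] by (auto simp: conv_power_def)
  next
    case (Suc i)
    have rec: "conv_power p (Suc i) j = (\<Sum>k\<le>j. p k * conv_power p i (j - k))" for j
      by (simp add: conv_power_def fps_mult_nth atLeast0AtMost)
    have nonneg: "0 \<le> conv_power p i j" for j
      using Suc by blast
    have "(\<lambda>j. \<Sum>k\<le>j. (p k * s ^ k) * (conv_power p i (j - k) * s ^ (j - k)))
        sums ((\<Sum>k. p k * s ^ k) * (\<Sum>j. conv_power p i j * s ^ j))"
      by (rule Cauchy_product_sums)
        (use sums Suc p s nonneg in \<open>auto simp: sums_iff abs_mult\<close>)
    also have "(\<lambda>j. \<Sum>k\<le>j. (p k * s ^ k) * (conv_power p i (j - k) * s ^ (j - k)))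
        = (\<lambda>j. conv_power p (Suc i) j * s ^ j)"
      unfolding rec sum_distrib_right
      by (intro ext sum.cong) (auto simp: mult_ac simp flip: power_add)
    finally have "(\<lambda>j. conv_power p (Suc i) j * s ^ j) sums F ^ Suc i"
      using sums Suc by (simp add: sums_iff)
    moreover have "0 \<le> conv_power p (Suc i) j" for j
      unfolding rec by (intro sum_nonneg mult_nonneg_nonneg p nonneg)
    ultimately show ?case by blast
  qed
  then show "0 \<le> conv_power p i j" "(\<lambda>j. conv_power p i j * s ^ j) sums F ^ i"
    by auto
qed

section \<open>Transition probabilities of the Markov process\<close>

context homogeneous_markov_process
begin

lemma trans_prob_nonneg: "0 \<le> trans_prob Pr Z i j t"
  by (simp add: trans_prob_def)

lemma measurable_state_UNIV:
  assumes "i \<in> E" "0 \<le> t"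
  shows "Z t \<in> Pr i \<rightarrow>\<^sub>M count_space UNIV"
  using measurable_comp[OF measurable_state[OF assms], of id] by simp

lemma state_in_E: "i \<in> E \<Longrightarrow> 0 \<le> t \<Longrightarrow> \<omega> \<in> space (Pr i) \<Longrightarrow> Z t \<omega> \<in> E"
  using measurable_space[OF measurable_state] by simp

text \<open>Allows sums over the state space to be written as series over all natural
  numbers.\<close>

lemma trans_prob_outside:
  assumes "i \<in> E" "0 \<le> t" "j \<notin> E"
  shows "trans_prob Pr Z i j t = 0"
proof -
  have "{\<omega> \<in> space (Pr i). Z t \<omega> = j} = {}"
    using state_in_E[OF assms(1,2)] assms(3) by auto
  then show ?thesis unfolding trans_prob_def by (simp only: measure_empty)
qed

lemma trans_prob_0:
  assumes i: "i \<in> E"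
  shows "trans_prob Pr Z i i 0 = 1"
proof -
  interpret prob_space "Pr i" by (rule prob_space_law[OF i])
  note [measurable] = measurable_state_UNIV[OF i order_refl]
  show ?thesis
    unfolding trans_prob_def by (subst prob_Collect_eq_1) (use initial_state[OF i] in auto)
qed

lemma joint_prob:
  assumes i: "i \<in> E" and j: "j \<in> E" and t: "0 \<le> t" and h: "0 \<le> h"
  shows "\<P>(\<omega> in Pr i. Z (t + h) \<omega> = j \<and> Z t \<omega> = k) = trans_prob Pr Z i k t * trans_prob Pr Z k j h"
proof -
  interpret prob_space "Pr i" by (rule prob_space_law[OF i])
  note [measurable] = measurable_state_UNIV[OF i t] measurable_state_UNIV[OF i add_nonneg_nonneg[OF t h]]
  show ?thesis
  \<comment> \<open>The Markov property conditions on events of positive probability only; for a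
    null event both sides are \<open>0\<close>.\<close>
  proof (cases "trans_prob Pr Z i k t = 0")
    case True
    have "\<P>(\<omega> in Pr i. Z (t + h) \<omega> = j \<and> Z t \<omega> = k) \<le> \<P>(\<omega> in Pr i. Z t \<omega> = k)"
      by (intro finite_measure_mono) auto
    with True show ?thesis
      by (simp add: trans_prob_def measure_le_0_iff)
  next
    case False
    then have "\<P>(\<omega> in Pr i. Z t \<omega> = k) > 0"
      by (simp add: trans_prob_def zero_less_measure_iff)
    \<comment> \<open>A single observation time is the instance \<open>n = 0\<close> of the Markov
      property.\<close>
    moreover have "strict_mono_on {..0::nat} (\<lambda>_. t)"
      by (auto simp: strict_mono_on_def)
    ultimately have "\<P>(\<omega> in Pr i. Z (t + h) \<omega> = j \<bar> Z t \<omega> = k) = trans_prob Pr Z k j h"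
      using markov_property[OF i j, where n = 0 and ts = "\<lambda>_. t" and x = "\<lambda>_. k" and h = h] t h
      by simp
    then show ?thesis
      using False by (simp add: cond_prob_def trans_prob_def field_simps)
  qed
qed

text \<open>On the event \<open>Z t = j\<close> the integrand is the constant
  \<open>s ^ j\<close>.\<close>

lemma expectation_pow_sums:
  assumes i: "i \<in> E" and t: "0 \<le> t" and s: "0 \<le> s" "s \<le> 1"
  shows "(\<lambda>j. trans_prob Pr Z i j t * s ^ j) sums (\<integral>\<omega>. s ^ Z t \<omega> \<partial>Pr i)"
proof -
  interpret prob_space "Pr i" by (rule prob_space_law[OF i])
  note [measurable] = measurable_state_UNIV[OF i t]
  have "integrable (Pr i) (\<lambda>\<omega>. s ^ Z t \<omega>)"
    using s by (intro integrable_const_bound[where B = 1]) (auto simp: power_le_one)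
  from integral_partition_nat_sums[OF this measurable_state_UNIV[OF i t]]
  have "(\<lambda>j. \<integral>\<omega>. s ^ Z t \<omega> * of_bool (Z t \<omega> = j) \<partial>Pr i) sums (\<integral>\<omega>. s ^ Z t \<omega> \<partial>Pr i)" .
  also have "(\<lambda>j. \<integral>\<omega>. s ^ Z t \<omega> * of_bool (Z t \<omega> = j) \<partial>Pr i) = (\<lambda>j. trans_prob Pr Z i j t * s ^ j)"
  proof
    fix j
    have "(\<integral>\<omega>. s ^ Z t \<omega> * of_bool (Z t \<omega> = j) \<partial>Pr i)
        = (\<integral>\<omega>. s ^ j * indicator {\<omega> \<in> space (Pr i). Z t \<omega> = j} \<omega> \<partial>Pr i)"
      by (intro Bochner_Integration.integral_cong) (auto simp: indicator_def)
    also have "\<dots> = trans_prob Pr Z i j t * s ^ j"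
      by (simp add: trans_prob_def)
    finally show "(\<integral>\<omega>. s ^ Z t \<omega> * of_bool (Z t \<omega> = j) \<partial>Pr i) = trans_prob Pr Z i j t * s ^ j" .
  qed
  finally show ?thesis .
qed

text \<open>The same splitting by the value at time \<open>t + h\<close>, restricted to paths that
  are in \<open>k\<close> at time \<open>t\<close>. Summing over \<open>k\<close> later yields the
  semigroup property.\<close>

lemma expectation_pow_restrict_sums:
  assumes i: "i \<in> E" and t: "0 \<le> t" and h: "0 \<le> h" and s: "0 \<le> s" "s \<le> 1"
  shows "(\<lambda>j. (trans_prob Pr Z i k t * trans_prob Pr Z k j h) * s ^ j)
           sums (\<integral>\<omega>. s ^ Z (t + h) \<omega> * of_bool (Z t \<omega> = k) \<partial>Pr i)"
proof -
  interpret prob_space "Pr i" by (rule prob_space_law[OF i])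
  have th: "0 \<le> t + h" using t h by simp
  note [measurable] = measurable_state_UNIV[OF i t] measurable_state_UNIV[OF i th]
  have "integrable (Pr i) (\<lambda>\<omega>. s ^ Z (t + h) \<omega> * of_bool (Z t \<omega> = k))"
    using s by (intro integrable_const_bound[where B = 1]) (auto simp: power_le_one)
  from integral_partition_nat_sums[OF this measurable_state_UNIV[OF i th]]
  have "(\<lambda>j. \<integral>\<omega>. s ^ Z (t + h) \<omega> * of_bool (Z t \<omega> = k) * of_bool (Z (t + h) \<omega> = j) \<partial>Pr i)
      sums (\<integral>\<omega>. s ^ Z (t + h) \<omega> * of_bool (Z t \<omega> = k) \<partial>Pr i)" .
  also have "(\<lambda>j. \<integral>\<omega>. s ^ Z (t + h) \<omega> * of_bool (Z t \<omega> = k) * of_bool (Z (t + h) \<omega> = j) \<partial>Pr i)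
      = (\<lambda>j. (trans_prob Pr Z i k t * trans_prob Pr Z k j h) * s ^ j)"
  proof
    fix j
    have "(\<integral>\<omega>. s ^ Z (t + h) \<omega> * of_bool (Z t \<omega> = k) * of_bool (Z (t + h) \<omega> = j) \<partial>Pr i)
        = (\<integral>\<omega>. s ^ j * indicator {\<omega> \<in> space (Pr i). Z (t + h) \<omega> = j \<and> Z t \<omega> = k} \<omega> \<partial>Pr i)"
      by (intro Bochner_Integration.integral_cong) (auto simp: indicator_def)
    also have "\<dots> = \<P>(\<omega> in Pr i. Z (t + h) \<omega> = j \<and> Z t \<omega> = k) * s ^ j"
      by simp
    also have "\<P>(\<omega> in Pr i. Z (t + h) \<omega> = j \<and> Z t \<omega> = k) = trans_prob Pr Z i k t * trans_prob Pr Z k j h"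
    proof (cases "j \<in> E")
      case True
      then show ?thesis using joint_prob[OF i _ t h] by simp
    next
      case False
      have "{\<omega> \<in> space (Pr i). Z (t + h) \<omega> = j \<and> Z t \<omega> = k} = {}"
        using state_in_E[OF i th] False by auto
      \<comment> \<open>For \<open>k\<close> outside \<open>E\<close> the first factor vanishes; for
        \<open>k\<close> in \<open>E\<close> the second does, as \<open>j\<close> lies
        outside.\<close>
      moreover have "trans_prob Pr Z i k t * trans_prob Pr Z k j h = 0"
        using trans_prob_outside[OF i t, of k] trans_prob_outside[OF _ h False, of k] by auto
      ultimately show ?thesis by (simp only: measure_empty)
    qed
    finally show "(\<integral>\<omega>. s ^ Z (t + h) \<omega> * of_bool (Z t \<omega> = k) * of_bool (Z (t + h) \<omega> = j) \<partial>Pr i)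
      = (trans_prob Pr Z i k t * trans_prob Pr Z k j h) * s ^ j" .
  qed
  finally show ?thesis .
qed

lemma trans_prob_sums_1:
  assumes "i \<in> E" "0 \<le> t"
  shows "(\<lambda>j. trans_prob Pr Z i j t) sums 1"
  using expectation_pow_sums[OF assms, of 1] prob_space.prob_space[OF prob_space_law[OF assms(1)]]
  by simp

text \<open>Passing through \<open>k\<close> at time \<open>t\<close> is one of the ways to be in
  \<open>j\<close> at time \<open>t + h\<close>. For \<open>i = j = k = 1\<close> this is
  supermultiplicativity in time.\<close>

lemma trans_prob_mult_le:
  assumes i: "i \<in> E" and j: "j \<in> E" and t: "0 \<le> t" and h: "0 \<le> h"
  shows "trans_prob Pr Z i k t * trans_prob Pr Z k j h \<le> trans_prob Pr Z i j (t + h)"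
proof -
  interpret prob_space "Pr i" by (rule prob_space_law[OF i])
  note [measurable] = measurable_state_UNIV[OF i add_nonneg_nonneg[OF t h]]
  show ?thesis
    unfolding joint_prob[OF assms, symmetric] trans_prob_def[of _ _ i j]
    by (intro finite_measure_mono) auto
qed

end

section \<open>Generating functions and their semigroup property\<close>

context markov_branching_process
begin

lemma gen_fun_sums:
  assumes "0 \<le> t" "0 \<le> s" "s \<le> 1"
  shows "(\<lambda>j. trans_prob Pr Z 1 j t * s ^ j) sums gen_fun Pr Z t s"
  unfolding gen_fun_def using one_in_S assms by (intro expectation_pow_sums) auto

text \<open>The upper bound replaces \<open>s ^ j\<close> by \<open>1\<close> in every term except
  \<open>j = 1\<close>; a lower bound on the probability of state \<open>1\<close> will then keep
  the generating function away from \<open>1\<close>.\<close>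

lemma gen_fun_bounds:
  assumes t: "0 \<le> t" and s: "0 \<le> s" "s \<le> 1"
  shows "0 \<le> gen_fun Pr Z t s" and "gen_fun Pr Z t s \<le> 1 - trans_prob Pr Z 1 1 t * (1 - s)"
proof -
  note F = gen_fun_sums[OF assms]
  show "0 \<le> gen_fun Pr Z t s"
    using F s by (intro sums_le[OF _ sums_zero F]) (auto simp: trans_prob_nonneg)
  have *: "(\<lambda>j. trans_prob Pr Z 1 j t - (if j = 1 then trans_prob Pr Z 1 j t * (1 - s) else 0))
      sums (1 - trans_prob Pr Z 1 1 t * (1 - s))"
    using one_in_S t by (intro sums_diff trans_prob_sums_1 sums_single) auto
  show "gen_fun Pr Z t s \<le> 1 - trans_prob Pr Z 1 1 t * (1 - s)"
    by (rule sums_le[OF _ F *])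
      (use s in \<open>auto simp: right_diff_distrib intro!: mult_left_le power_le_one trans_prob_nonneg\<close>)
qed

lemma branching_pow_sums:
  assumes i: "i \<in> insert 0 S" and t: "0 \<le> t" and s: "0 \<le> s" "s \<le> 1"
  shows "(\<lambda>j. trans_prob Pr Z i j t * s ^ j) sums gen_fun Pr Z t s ^ i"
proof -
  define p where "p = (\<lambda>k. trans_prob Pr Z 1 k t)"
  have p: "0 \<le> p k" for k
    by (simp add: p_def trans_prob_nonneg)
  note cp = conv_power_sums[OF p]
  have mass: "(\<lambda>j. conv_power p i j) sums 1"
    using cp(2)[where s = 1 and F = 1 and i = i] trans_prob_sums_1[of 1 t] one_in_S t by (simp add: p_def)
  \<comment> \<open>The branching property says nothing about \<open>j\<close> outside the state space; there \<open>conv_power\<close>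
      vanishes because both sequences have total mass \<open>1\<close>.\<close>
  have le: "trans_prob Pr Z i j t \<le> conv_power p i j" for j
  proof (cases "j \<in> insert 0 S")
    case True
    then show ?thesis using branching[OF i _ t] by (simp add: p_def)
  next
    case False
    then show ?thesis
      using trans_prob_outside[OF i t] cp(1)[where s = 1 and F = 1] trans_prob_sums_1[of 1 t] one_in_S t
      by (simp add: p_def)
  qed
  have "trans_prob Pr Z i j t = conv_power p i j" for j
  proof -
    have "(\<lambda>j. conv_power p i j - trans_prob Pr Z i j t) sums (1 - 1)"
      by (intro sums_diff mass trans_prob_sums_1 i t)
    then have "conv_power p i j - trans_prob Pr Z i j t = 0"
      using suminf_eq_zero_iff[of "\<lambda>j. conv_power p i j - trans_prob Pr Z i j t"] le
      by (auto simp: sums_iff)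
    then show ?thesis by simp
  qed
  then show ?thesis
    using cp(2)[OF s(1), where F = "gen_fun Pr Z t s" and i = i] gen_fun_sums[OF t s] by (simp add: p_def)
qed

text \<open>Condition on \<open>Z t = k\<close>: by branching, \<open>k\<close> individuals
  contribute \<open>gen_fun Pr Z h s ^ k\<close>, and averaging over the law of \<open>Z t\<close>
  composes the generating functions.\<close>

lemma gen_fun_add:
  assumes t: "0 \<le> t" and h: "0 \<le> h" and s: "0 \<le> s" "s \<le> 1"
  shows "gen_fun Pr Z (t + h) s = gen_fun Pr Z t (gen_fun Pr Z h s)"
proof -
  have one: "1 \<in> insert 0 S" using one_in_S by simp
  interpret prob_space "Pr 1" by (rule prob_space_law[OF one])
  have th: "0 \<le> t + h" using t h by simp
  note [measurable] = measurable_state_UNIV[OF one t] measurable_state_UNIV[OF one th]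
  have "integrable (Pr 1) (\<lambda>\<omega>. s ^ Z (t + h) \<omega>)"
    using s by (intro integrable_const_bound[where B = 1]) (auto simp: power_le_one simp del: One_nat_def)
  from integral_partition_nat_sums[OF this measurable_state_UNIV[OF one t]]
  have "(\<lambda>k. \<integral>\<omega>. s ^ Z (t + h) \<omega> * of_bool (Z t \<omega> = k) \<partial>Pr 1) sums gen_fun Pr Z (t + h) s"
    by (simp add: gen_fun_def)
  also have "(\<lambda>k. \<integral>\<omega>. s ^ Z (t + h) \<omega> * of_bool (Z t \<omega> = k) \<partial>Pr 1)
      = (\<lambda>k. trans_prob Pr Z 1 k t * gen_fun Pr Z h s ^ k)"
  proof
    fix k
    note L = expectation_pow_restrict_sums[OF one t h s, of k]
    show "(\<integral>\<omega>. s ^ Z (t + h) \<omega> * of_bool (Z t \<omega> = k) \<partial>Pr 1)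
        = trans_prob Pr Z 1 k t * gen_fun Pr Z h s ^ k"
    proof (cases "k \<in> insert 0 S")
      case True
      from sums_mult[OF branching_pow_sums[OF this h s], of "trans_prob Pr Z 1 k t"] L
      show ?thesis by (intro sums_unique2[OF L]) (simp add: mult.assoc)
    next
      \<comment> \<open>Branching is available for states only; for any other \<open>k\<close> the
        weight is \<open>0\<close> and the integral is a sum of zeros.\<close>
      case False
      then show ?thesis
        using L trans_prob_outside[OF one t] by (simp add: sums_iff)
    qed
  qed
  finally show ?thesis
    using gen_fun_sums[OF t gen_fun_bounds(1)[OF h s]] gen_fun_bounds(2)[OF h s] s
      mult_nonneg_nonneg[OF trans_prob_nonneg[of 1 1 h], of "1 - s"]
    by (auto intro: sums_unique2)
qed

end

section \<open>Differentiability from forward increments\<close>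

text \<open>Only forward increments are controlled, but uniformly in their left endpoint. This gives
  the left derivative too: for \<open>v < t\<close> the increment starts at the moving point
  \<open>v\<close>, and continuity of \<open>g\<close> with a Lipschitz bound on \<open>x\<close>
  replaces \<open>g (x v)\<close> by \<open>g (x t)\<close>.\<close>

lemma has_real_derivative_from_uniform_increment:
  fixes x g :: "real \<Rightarrow> real"
  assumes g: "continuous_on {0..r} g"
    and x: "\<And>u. u \<in> {0..T} \<Longrightarrow> x u \<in> {0..r}"
    and incr: "\<And>\<epsilon>. 0 < \<epsilon> \<Longrightarrow> \<forall>\<^sub>F h in at_right 0. \<forall>u. 0 \<le> u \<longrightarrow> u + h \<le> T \<longrightarrow>
                  \<bar>x (u + h) - x u - h * g (x u)\<bar> \<le> \<epsilon> * h"
    and t: "t \<in> {0..T}"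
  shows "(x has_real_derivative g (x t)) (at t within {0..T})"
proof -
  have "bounded (g ` {0..r})"
    by (intro compact_imp_bounded compact_continuous_image g) simp
  then obtain M where "0 < M" and "\<And>y. y \<in> {0..r} \<Longrightarrow> \<bar>g y\<bar> \<le> M"
    by (auto simp: bounded_pos)
  then have gM: "\<bar>g (x u)\<bar> \<le> M" if "u \<in> {0..T}" for u
    using x[OF that] by blast
  obtain d0 where "0 < d0" and d0: "\<And>h u. 0 < h \<Longrightarrow> h < d0 \<Longrightarrow> 0 \<le> u \<Longrightarrow> u + h \<le> T \<Longrightarrow>
      \<bar>x (u + h) - x u - h * g (x u)\<bar> \<le> h"
    using incr[of 1] by (auto simp: eventually_at_right_field)
  have lip: "\<bar>x v - x u\<bar> \<le> (M + 1) * (v - u)"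
    if "0 \<le> u" "u < v" "v \<le> T" "v - u < d0" for u v
  proof -
    have "\<bar>x v - x u - (v - u) * g (x u)\<bar> \<le> v - u"
      using d0[of "v - u" u] that by simp
    moreover have "\<bar>(v - u) * g (x u)\<bar> \<le> (v - u) * M"
      using gM[of u] that by (simp add: abs_mult mult_left_mono)
    ultimately show ?thesis
      by (simp add: algebra_simps)
  qed
  have "((\<lambda>v. (x v - x t) / (v - t)) \<longlongrightarrow> g (x t)) (at t within {0..T})"
    unfolding tendsto_iff dist_real_def
  proof (intro allI impI)
    fix e :: real assume "0 < e"
    then obtain d1 where "0 < d1" and d1: "\<And>h u. 0 < h \<Longrightarrow> h < d1 \<Longrightarrow> 0 \<le> u \<Longrightarrow> u + h \<le> T \<Longrightarrow>
      \<bar>x (u + h) - x u - h * g (x u)\<bar> \<le> e / 3 * h"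
      using incr[of "e / 3"] by (auto simp: eventually_at_right_field)
    from g x[OF t] obtain d2 where "0 < d2"
      and d2: "\<And>y. y \<in> {0..r} \<Longrightarrow> \<bar>y - x t\<bar> < d2 \<Longrightarrow> \<bar>g y - g (x t)\<bar> < e / 3"
      using \<open>0 < e\<close> unfolding continuous_on_iff dist_real_def
      by (metis divide_pos_pos zero_less_numeral)
    \<comment> \<open>\<open>d0\<close> makes the Lipschitz bound apply, \<open>d1\<close> the
      estimate with error \<open>e / 3\<close>, and \<open>d2 / (M + 1)\<close> forces
      \<open>x\<close> to move by less than \<open>d2\<close>.\<close>
    define d where "d = min (min d0 d1) (d2 / (M + 1))"
    have "0 < d"
      using \<open>0 < d0\<close> \<open>0 < d1\<close> \<open>0 < d2\<close> \<open>0 < M\<close> by (simp add: d_def)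
    have "\<bar>(x v - x t) / (v - t) - g (x t)\<bar> < e"
      if v: "v \<in> {0..T}" "v \<noteq> t" "\<bar>v - t\<bar> < d" for v
    proof -
      \<comment> \<open>The difference quotient is symmetric, so ordering the two times handles both
        one-sided derivatives at once.\<close>
      define u w where "u = min v t" and "w = max v t"
      have uw: "0 \<le> u" "u < w" "w \<le> T" "w - u < d" "u \<in> {0..T}"
        using v t by (auto simp: u_def w_def)
      have quot: "(x v - x t) / (v - t) = (x w - x u) / (w - u)"
        by (cases "v < t") (auto simp: u_def w_def divide_simps, auto simp: algebra_simps)
      have "\<bar>x w - x u - (w - u) * g (x u)\<bar> \<le> e / 3 * (w - u)"
        using d1[of "w - u" u] uw by (simp add: d_def)
      then have "\<bar>(x w - x u - (w - u) * g (x u)) / (w - u)\<bar> \<le> e / 3"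
        using uw by (simp add: divide_simps)
      then have "\<bar>(x w - x u) / (w - u) - g (x u)\<bar> \<le> e / 3"
        using uw by (simp add: diff_divide_distrib)
      moreover have "\<bar>g (x u) - g (x t)\<bar> < e / 3"
      proof (rule d2)
        have "(M + 1) * (w - u) < d2"
          using uw \<open>0 < M\<close> by (auto simp: d_def pos_less_divide_eq mult.commute)
        then have "\<bar>x w - x u\<bar> < d2"
          using lip[of u w] uw by (simp add: d_def)
        then show "\<bar>x u - x t\<bar> < d2"
          using \<open>0 < d2\<close> by (auto simp: u_def w_def min_def max_def split: if_splits)
      qed (rule x[OF uw(5)])
      ultimately show ?thesis
        using \<open>0 < e\<close> unfolding quot by linarith
    qed
    then show "\<forall>\<^sub>F v in at t within {0..T}. \<bar>(x v - x t) / (v - t) - g (x t)\<bar> < e"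
      unfolding eventually_at dist_real_def using \<open>0 < d\<close> by blast
  qed
  then show ?thesis
    by (simp add: has_field_derivative_iff)
qed

section \<open>The backward equation\<close>

context markov_branching_process
begin

text \<open>\<open>a\<close> is arbitrary off the state space; setting it to \<open>0\<close> there
  turns \<open>inf_gf\<close> into an ordinary power series.\<close>

definition rate :: "nat \<Rightarrow> real" where
  "rate j = (if j \<in> insert 0 S then a j else 0)"

text \<open>Comparison with the summable nonnegative rates handles all states except
  \<open>1\<close>, whose single term is then added back. The case \<open>s = 1\<close> shows that
  the radius of convergence is at least \<open>1\<close>.\<close>

lemma inf_gf_sums:
  assumes s: "0 \<le> s" "s \<le> 1"
  shows "(\<lambda>j. rate j * s ^ j) sums inf_gf S a s"
proof -
  have "a summable_on (insert 0 S - {1})"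
    using rates_sum by (auto simp: summable_on_def)
  then have "(\<lambda>j. a j * s ^ j) summable_on (insert 0 S - {1})"
    by (rule summable_on_comparison_test)
      (use s rates_nonneg in \<open>auto intro!: mult_left_le power_le_one\<close>)
  then have "(\<lambda>j. a j * s ^ j) summable_on insert 1 (insert 0 S - {1})"
    by (subst summable_on_insert_iff)
  also have "insert 1 (insert 0 S - {1}) = insert 0 S"
    using one_in_S by auto
  finally have "((\<lambda>j. a j * s ^ j) has_sum inf_gf S a s) (insert 0 S)"
    unfolding inf_gf_def by (rule has_sum_infsum)
  then have "((\<lambda>j. rate j * s ^ j) has_sum inf_gf S a s) UNIV"
    by (subst has_sum_cong_neutral[where T = "insert 0 S" and g = "\<lambda>j. a j * s ^ j"])
      (auto simp: rate_def)
  then show ?thesis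
    by (rule has_sum_imp_sums)
qed

text \<open>For a state other than \<open>1\<close> the rate is one term of a nonnegative family
  with sum \<open>- a 1\<close>.\<close>

lemma abs_rate_le: "\<bar>rate j\<bar> \<le> - a 1"
proof (cases "j \<in> insert 0 S \<and> j \<noteq> 1")
  case True
  then have "(a has_sum a j) {j}"
    using has_sum_finite[of "{j}" a] by simp
  then have "a j \<le> - a 1"
    by (rule has_sum_mono_neutral[OF _ rates_sum]) (use True rates_nonneg in auto)
  then show ?thesis
    using True rates_nonneg by (auto simp: rate_def)
next
  case False
  then show ?thesis
    using rate_0_pos rate_0_less by (auto simp: rate_def)
qed

lemma continuous_on_inf_gf: "continuous_on {0..<1} (inf_gf S a)"
proof (subst continuous_on_cong[OF refl])
  show "inf_gf S a x = (\<Sum>j. rate j * x ^ j)" if "x \<in> {0..<1}" for x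
    using inf_gf_sums[of x] that by (simp add: sums_iff)
  show "continuous_on {0..<1} (\<lambda>x. \<Sum>j. rate j * x ^ j)"
  proof (intro continuous_at_imp_continuous_on ballI)
    fix x :: real assume "x \<in> {0..<1}"
    then show "isCont (\<lambda>x. \<Sum>j. rate j * x ^ j) x"
      using inf_gf_sums[of 1] by (intro isCont_powser[where K = 1]) (auto simp: sums_iff)
  qed
qed

text \<open>The infinitesimal assumption treats each \<open>j\<close> separately. With
  \<open>q h j\<close> the error of the \<open>j\<close>-th difference quotient, the deviation is at
  most \<open>h\<close> times the sum of \<open>\<bar>q h j\<bar> * r ^ j\<close>, which does not
  involve \<open>x\<close>; its convergence to \<open>0\<close> is therefore uniform.\<close>

lemma gen_fun_small_time:
  assumes r: "0 \<le> r" "r < 1" and "0 < \<epsilon>"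
  shows "\<forall>\<^sub>F h in at_right 0. \<forall>x\<in>{0..r}. \<bar>gen_fun Pr Z h x - x - h * inf_gf S a x\<bar> \<le> \<epsilon> * h"
proof -
  define p where "p h j = trans_prob Pr Z 1 j h" for h j
  define q where "q h j = (p h j - of_bool (j = 1)) / h - rate j" for h j
  have one: "1 \<in> insert 0 S"
    using one_in_S by simp
  have pos: "\<forall>\<^sub>F h in at_right 0. (0::real) < h"
    by (rule eventually_at_right_less)
  have q_lim: "((\<lambda>h. q h j) \<longlongrightarrow> 0) (at_right 0)" for j
  proof (cases "j \<in> insert 0 S")
    case True
    have "((\<lambda>h. (p h j - (of_bool (j = 1) + a j * h)) / h) \<longlongrightarrow> 0) (at_right 0)"
      unfolding p_def by (rule smalloD_tendsto[OF infinitesimal[OF True]])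
    moreover have "\<forall>\<^sub>F h in at_right 0. (p h j - (of_bool (j = 1) + a j * h)) / h = q h j"
      using pos by eventually_elim (use True in \<open>auto simp: q_def rate_def divide_simps\<close>)
    ultimately show ?thesis
      by (rule Lim_transform_eventually)
  next
    case False
    have "\<forall>\<^sub>F h in at_right 0. q h j = 0"
      using pos
      by eventually_elim (use False one trans_prob_outside[OF one _ False] in \<open>auto simp: q_def p_def rate_def\<close>)
    then show ?thesis by (rule tendsto_eventually)
  qed
  \<comment> \<open>All jumps together have probability \<open>1 - p h 1 = O(h)\<close>, which dominates every \<open>q h j\<close>
      uniformly in \<open>j\<close>, so \<open>r < 1\<close> makes Tannery's theorem applicable.\<close>
  define C where "C = 1 - 2 * a 1"
  have q_bound: "\<forall>\<^sub>F h in at_right 0. \<forall>j. \<bar>q h j\<bar> \<le> C"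
  proof -
    have "\<forall>\<^sub>F h in at_right 0. \<bar>q h 1\<bar> < 1"
      using tendstoD[OF q_lim[of 1], of 1] by (simp add: dist_real_def)
    with pos show ?thesis
    proof eventually_elim
      case (elim h)
      show ?case
      proof
        fix j
        have psums: "(\<lambda>j. p h j) sums 1" and pn: "0 \<le> p h j" for j
          using trans_prob_sums_1[OF one, of h] elim trans_prob_nonneg by (auto simp: p_def)
        have "\<bar>p h j - of_bool (j = 1)\<bar> \<le> 1 - p h 1"
        proof (cases "j = 1")
          case True
          have "p h 1 \<le> 1"
            using sum_le_suminf[of "p h" "{1}"] psums pn by (auto simp: sums_iff)
          with True show ?thesis by simp
        next
          case False
          have "p h 1 + p h j \<le> 1"
            using sum_le_suminf[of "p h" "{1, j}"] psums pn False by (auto simp: sums_iff)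
          with False pn show ?thesis by simp
        qed
        then have "\<bar>(p h j - of_bool (j = 1)) / h\<bar> \<le> (1 - p h 1) / h"
          using elim by (simp add: divide_right_mono)
        \<comment> \<open>As \<open>\<bar>q h 1\<bar> < 1\<close>, this is at most
          \<open>1 - a 1\<close>; the bound \<open>- a 1\<close> on
          \<open>\<bar>rate j\<bar>\<close> supplies the rest of \<open>C\<close>.\<close>
        also have "(1 - p h 1) / h = - q h 1 - a 1"
          using one by (simp add: q_def rate_def diff_divide_distrib)
        also have "\<dots> \<le> 1 - a 1"
          using elim by simp
        finally show "\<bar>q h j\<bar> \<le> C"
          using abs_rate_le[of j] unfolding q_def C_def by linarith
      qed
    qed
  qed
  have "(\<forall>\<^sub>F h in at_right 0. summable (\<lambda>j. norm (\<bar>q h j\<bar> * r ^ j))) \<and>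
      summable (\<lambda>j. norm ((\<lambda>_. 0::real) j)) \<and>
      ((\<lambda>h. \<Sum>j. \<bar>q h j\<bar> * r ^ j) \<longlongrightarrow> (\<Sum>j. (\<lambda>_. 0) j)) (at_right 0)"
  proof (rule tannerys_theorem[where M = "\<lambda>j. C * r ^ j"])
    show "((\<lambda>h. \<bar>q h j\<bar> * r ^ j) \<longlongrightarrow> 0) (at_right 0)" for j
      by (intro tendsto_mult_left_zero tendsto_rabs_zero q_lim)
    show "\<forall>\<^sub>F (j, h) in at_top \<times>\<^sub>F at_right 0. norm (\<bar>q h j\<bar> * r ^ j) \<le> C * r ^ j"
      using eventually_prodI[OF eventually_ge_at_top[of 0] q_bound]
      by eventually_elim (use r in \<open>auto simp: abs_mult intro!: mult_right_mono\<close>)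
    show "summable (\<lambda>j. C * r ^ j)"
      using r by (intro summable_mult summable_geometric) simp
  qed simp
  then have summ: "\<forall>\<^sub>F h in at_right 0. summable (\<lambda>j. \<bar>q h j\<bar> * r ^ j)"
    and lim: "((\<lambda>h. \<Sum>j. \<bar>q h j\<bar> * r ^ j) \<longlongrightarrow> 0) (at_right 0)"
    using r by (simp_all add: abs_mult)
  from order_tendstoD(2)[OF lim \<open>0 < \<epsilon>\<close>] summ pos show ?thesis
  proof eventually_elim
    case (elim h)
    show ?case
    proof
      fix x assume x: "x \<in> {0..r}"
      have "(\<lambda>j. p h j * x ^ j - (if j = 1 then x else 0) - h * (rate j * x ^ j))
          sums (gen_fun Pr Z h x - x - h * inf_gf S a x)"
        unfolding p_def using elim x r
        by (intro sums_diff sums_mult gen_fun_sums inf_gf_sums sums_single) auto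
      also have "(\<lambda>j. p h j * x ^ j - (if j = 1 then x else 0) - h * (rate j * x ^ j))
          = (\<lambda>j. h * (q h j * x ^ j))"
      proof
        fix j
        show "p h j * x ^ j - (if j = 1 then x else 0) - h * (rate j * x ^ j) = h * (q h j * x ^ j)"
          using elim by (cases "j = 1") (simp_all add: q_def field_simps)
      qed
      finally have eq: "gen_fun Pr Z h x - x - h * inf_gf S a x = (\<Sum>j. h * (q h j * x ^ j))"
        by (simp add: sums_iff)
      have le: "norm (h * (q h j * x ^ j)) \<le> h * (\<bar>q h j\<bar> * r ^ j)" for j
        using elim x by (auto simp: abs_mult intro!: mult_left_mono power_mono)
      have "\<bar>gen_fun Pr Z h x - x - h * inf_gf S a x\<bar> \<le> (\<Sum>j. h * (\<bar>q h j\<bar> * r ^ j))"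
        using norm_suminf_le[OF le] summable_mult[OF elim(2), of h] unfolding eq by simp
      also have "\<dots> = h * (\<Sum>j. \<bar>q h j\<bar> * r ^ j)"
        using elim by (intro suminf_mult) auto
      also have "\<dots> \<le> \<epsilon> * h"
        using elim by (simp add: mult.commute)
      finally show "\<bar>gen_fun Pr Z h x - x - h * inf_gf S a x\<bar> \<le> \<epsilon> * h" .
    qed
  qed
qed

text \<open>For short times the probability is at least \<open>1 / 2\<close>. Cutting
  \<open>{0..t}\<close> into \<open>n\<close> short pieces, supermultiplicativity gives
  \<open>(1 / 2) ^ n\<close>, with \<open>n\<close> the same for all \<open>t\<close> in
  \<open>{0..T}\<close>.\<close>

lemma trans_prob_11_bounded_below:
  obtains c where "0 < c" and "\<And>t. t \<in> {0..T} \<Longrightarrow> c \<le> trans_prob Pr Z 1 1 t"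
proof -
  have one: "1 \<in> insert 0 S"
    using one_in_S by simp
  have pos: "\<forall>\<^sub>F h in at_right 0. (0::real) < h"
    by (rule eventually_at_right_less)
  have "((\<lambda>h. (trans_prob Pr Z 1 1 h - (1 + a 1 * h)) / h) \<longlongrightarrow> 0) (at_right 0)"
    using smalloD_tendsto[OF infinitesimal[OF one]] by simp
  \<comment> \<open>For \<open>h > 0\<close> this expression equals
    \<open>trans_prob Pr Z 1 1 h\<close>, which therefore tends to \<open>1\<close>.\<close>
  then have "((\<lambda>h. (trans_prob Pr Z 1 1 h - (1 + a 1 * h)) / h * h + (1 + a 1 * h))
      \<longlongrightarrow> 0 * 0 + (1 + a 1 * 0)) (at_right 0)"
    by (intro tendsto_intros)
  then have "\<forall>\<^sub>F h in at_right 0.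
      1 / 2 < (trans_prob Pr Z 1 1 h - (1 + a 1 * h)) / h * h + (1 + a 1 * h)"
    by (rule order_tendstoD) simp
  then have "\<forall>\<^sub>F h in at_right 0. 1 / 2 < trans_prob Pr Z 1 1 h"
    using pos by eventually_elim simp
  then obtain d where "0 < d" and d: "\<And>h. 0 < h \<Longrightarrow> h < d \<Longrightarrow> 1 / 2 < trans_prob Pr Z 1 1 h"
    by (auto simp: eventually_at_right_field)
  then have small: "1 / 2 \<le> trans_prob Pr Z 1 1 h" if "0 \<le> h" "h < d" for h
    using trans_prob_0[OF one] that by (cases "h = 0") (simp_all add: less_imp_le del: One_nat_def)
  \<comment> \<open>Such an \<open>n\<close> is positive and makes every step \<open>t / n\<close>
    shorter than \<open>d\<close>.\<close>
  obtain n :: nat where n: "max 0 (T / d) < real n"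
    using reals_Archimedean2 by blast
  show thesis
  proof (rule that)
    fix t assume t: "t \<in> {0..T}"
    define h where "h = t / n"
    have "T < d * n"
      using n \<open>0 < d\<close> by (simp add: divide_simps mult.commute)
    with t n have h: "0 \<le> h" "h < d"
      by (auto simp: h_def divide_simps)
    have "(1 / 2) ^ k \<le> trans_prob Pr Z 1 1 (real k * h)" for k
    proof (induction k)
      case 0
      then show ?case using trans_prob_0[OF one] by simp
    next
      case (Suc k)
      have "(1 / 2) ^ Suc k = (1 / 2) ^ k * (1 / 2 :: real)"
        by simp
      also have "\<dots> \<le> trans_prob Pr Z 1 1 (real k * h) * trans_prob Pr Z 1 1 h"
        using Suc small[OF h] by (intro mult_mono trans_prob_nonneg) auto
      also have "\<dots> \<le> trans_prob Pr Z 1 1 (real k * h + h)"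
        using one h by (intro trans_prob_mult_le) auto
      finally show ?case by (simp add: algebra_simps)
    qed
    from this[of n] show "(1 / 2) ^ n \<le> trans_prob Pr Z 1 1 t"
      using n by (simp add: h_def)
  qed simp
qed

text \<open>Confines the trajectory up to time \<open>T\<close> to a compact part of
  \<open>{0..<1}\<close>, where \<open>inf_gf\<close> is continuous and the small-time expansion is
  uniform.\<close>

lemma gen_fun_bounded_away_from_1:
  assumes s: "0 \<le> s" "s < 1"
  obtains r where "r < 1" and "\<And>t. t \<in> {0..T} \<Longrightarrow> gen_fun Pr Z t s \<in> {0..r}"
proof -
  obtain c where "0 < c" and c: "\<And>t. t \<in> {0..T} \<Longrightarrow> c \<le> trans_prob Pr Z 1 1 t"
    using trans_prob_11_bounded_below by blast
  show thesis
  proof (rule that)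
    show "1 - c * (1 - s) < 1"
      using \<open>0 < c\<close> s by simp
    fix t assume t: "t \<in> {0..T}"
    have "c * (1 - s) \<le> trans_prob Pr Z 1 1 t * (1 - s)"
      using c[OF t] s by (intro mult_right_mono) auto
    then show "gen_fun Pr Z t s \<in> {0..1 - c * (1 - s)}"
      using gen_fun_bounds(1)[of t s] order_trans[OF gen_fun_bounds(2)[of t s]] t s by auto
  qed
qed

lemma gen_fun_less_1:
  assumes "0 \<le> t" "0 \<le> s" "s < 1"
  shows "gen_fun Pr Z t s < 1"
proof -
  obtain r where "r < 1" and "gen_fun Pr Z t s \<in> {0..r}"
    using gen_fun_bounded_away_from_1[OF assms(2,3), of t] assms(1) by (metis atLeastAtMost_iff order_refl)
  then show ?thesis by simp
qed

lemma gen_fun_0: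
  assumes s: "0 \<le> s" "s \<le> 1"
  shows "gen_fun Pr Z 0 s = s"
proof -
  have one: "1 \<in> insert 0 S"
    using one_in_S by simp
  interpret prob_space "Pr 1" by (rule prob_space_law[OF one])
  note [measurable] = measurable_state_UNIV[OF one order_refl]
  have "gen_fun Pr Z 0 s = (\<integral>\<omega>. s \<partial>Pr 1)"
    unfolding gen_fun_def
    by (rule integral_cong_AE) (use initial_state[OF one] in \<open>auto simp del: One_nat_def\<close>)
  then show ?thesis
    using prob_space by simp
qed

theorem gen_fun_has_real_derivative:
  assumes s: "0 \<le> s" "s < 1" and t: "t \<in> {0..T}"
  shows "((\<lambda>t. gen_fun Pr Z t s) has_real_derivative inf_gf S a (gen_fun Pr Z t s)) (at t within {0..T})"
proof -
  obtain r where r1: "r < 1" and range: "\<And>u. u \<in> {0..T} \<Longrightarrow> gen_fun Pr Z u s \<in> {0..r}"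
    using gen_fun_bounded_away_from_1[OF s] by blast
  have r0: "0 \<le> r"
    using range[OF t] by simp
  show ?thesis
  proof (rule has_real_derivative_from_uniform_increment[OF _ range _ t])
    show "continuous_on {0..r} (inf_gf S a)"
      by (rule continuous_on_subset[OF continuous_on_inf_gf]) (use r1 in auto)
    fix \<epsilon> :: real assume "0 < \<epsilon>"
    from gen_fun_small_time[OF r0 r1 this] eventually_at_right_less[of 0]
    show "\<forall>\<^sub>F h in at_right 0. \<forall>u. 0 \<le> u \<longrightarrow> u + h \<le> T \<longrightarrow>
        \<bar>gen_fun Pr Z (u + h) s - gen_fun Pr Z u s - h * inf_gf S a (gen_fun Pr Z u s)\<bar> \<le> \<epsilon> * h"
    proof eventually_elim
      case (elim h)
      show ?case
      proof (intro allI impI)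
        \<comment> \<open>The semigroup property is used in the order
          \<open>F(h + u; s) = F(h; F(u; s))\<close>, so the small-time expansion is taken at the
          point \<open>F(u; s)\<close>.\<close>
        fix u :: real assume u: "0 \<le> u" "u + h \<le> T"
        then show "\<bar>gen_fun Pr Z (u + h) s - gen_fun Pr Z u s - h * inf_gf S a (gen_fun Pr Z u s)\<bar> \<le> \<epsilon> * h"
          using elim range[of u] gen_fun_add[of h u s] s by (simp add: add.commute)
      qed
    qed
  qed
qed

end

section \<open>Calculus for \<open>1 / \<Lambda>(R)\<close> and comparison with a linear
  function\<close>

lemma nonneg_derivative_within_imp_le:
  fixes f f' :: "real \<Rightarrow> real"
  assumes "a \<le> b"
    and f: "\<And>x. x \<in> {a..b} \<Longrightarrow> (f has_real_derivative f' x) (at x within {a..b})"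
    and f': "\<And>x. x \<in> {a..b} \<Longrightarrow> 0 \<le> f' x"
  shows "f a \<le> f b"
proof (rule DERIV_nonneg_imp_increasing_open[OF assms(1)])
  show "\<exists>y. (f has_real_derivative y) (at x) \<and> 0 \<le> y" if "a < x" "x < b" for x
    using f[of x] f'[of x] that by (auto simp: at_within_Icc_at)
  show "continuous_on {a..b} f"
    by (rule DERIV_continuous_on[OF f])
qed

text \<open>The equation for \<open>R\<close> contributes a factor \<open>\<Lambda> (R u)\<close>
  that cancels one of the two in the denominator. \<open>\<Lambda>\<close> is differentiated within
  \<open>B\<close>, so the chain rule needs \<open>R\<close> to stay in \<open>B\<close>.\<close>

lemma has_real_derivative_inverse_comp:
  fixes R \<Lambda> :: "real \<Rightarrow> real"
  assumes R: "\<And>u. u \<in> A \<Longrightarrow> R u \<in> B" and u: "u \<in> A"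
    and dR: "(R has_real_derivative - (R u * \<Lambda> (R u))) (at u within A)"
    and d\<Lambda>: "(\<Lambda> has_real_derivative \<Lambda>') (at (R u) within B)"
    and pos: "0 < \<Lambda> (R u)"
  shows "((\<lambda>u. 1 / \<Lambda> (R u)) has_real_derivative R u * \<Lambda>' / \<Lambda> (R u)) (at u within A)"
proof -
  have "(\<Lambda> has_real_derivative \<Lambda>') (at (R u) within R ` A)"
    by (rule has_field_derivative_subset[OF d\<Lambda>]) (use R in auto)
  from DERIV_image_chain[OF this dR]
  have "((\<lambda>u. \<Lambda> (R u)) has_real_derivative \<Lambda>' * - (R u * \<Lambda> (R u))) (at u within A)"
    by (simp add: o_def)
  then have "((\<lambda>u. 1 / \<Lambda> (R u)) has_real_derivative
      (0 * \<Lambda> (R u) - 1 * (\<Lambda>' * - (R u * \<Lambda> (R u)))) / (\<Lambda> (R u) * \<Lambda> (R u))) (at u within A)"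
    by (intro DERIV_divide DERIV_const) (use pos in auto)
  then show ?thesis
    using pos by (simp add: mult_ac)
qed

text \<open>\<open>x t = G 0 + \<nu> * t\<close> satisfies the equation without the term
  \<open>1 / G\<close>, and \<open>l / \<nu>\<close> is the integral of \<open>1 / x\<close>. The
  defect \<open>D = x + l / \<nu> - G\<close> is increasing because \<open>G \<ge> x\<close>, and
  its derivative is at most \<open>l / (\<nu> * x\<^sup>2)\<close>, whose integral over the
  half-line is \<open>1 / (\<nu>\<^sup>2 * G 0)\<close>.\<close>

lemma logarithmic_correction_bounds:
  fixes G :: "real \<Rightarrow> real"
  assumes \<nu>: "0 < \<nu>" and pos: "\<And>t. 0 \<le> t \<Longrightarrow> 0 < G t"
    and dG: "\<And>t b. t \<in> {0..b} \<Longrightarrow> (G has_real_derivative \<nu> + 1 / G t) (at t within {0..b})"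
    and b: "0 \<le> b"
  defines "l \<equiv> \<lambda>t. ln (1 / G 0 * \<nu> * t + 1)"
  shows "G b - G 0 \<le> \<nu> * b + 1 / \<nu> * l b"
    and "\<nu> * b + 1 / \<nu> * l b \<le> G b - G 0 + 1 / (\<nu>\<^sup>2 * G 0)"
proof -
  define x where "x t = G 0 + \<nu> * t" for t
  have G0: "0 < G 0"
    using pos by simp
  have x: "0 < x t" if "0 \<le> t" for t
    using that G0 \<nu> by (simp add: x_def add_pos_nonneg)
  have dl: "(l has_real_derivative \<nu> / x t) (at t within A)" if "0 \<le> t" for t A
  proof -
    have "1 / G 0 * \<nu> * t + 1 = x t / G 0"
      using G0 by (simp add: x_def field_simps)
    then show ?thesis
      using x[OF that] G0 unfolding l_def
      by (auto intro!: derivative_eq_intros simp: field_simps)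
  qed
  have dx: "(x has_real_derivative \<nu>) (at t within A)" for t A
    unfolding x_def by (auto intro!: derivative_eq_intros)
  have l0: "0 \<le> l t" if "0 \<le> t" for t
    using that \<nu> G0 by (simp add: l_def)
  have lower: "x t \<le> G t" if "0 \<le> t" for t
  proof -
    have "G 0 - \<nu> * 0 \<le> G t - \<nu> * t"
    proof (rule nonneg_derivative_within_imp_le[OF that])
      fix u assume u: "u \<in> {0..t}"
      show "((\<lambda>t. G t - \<nu> * t) has_real_derivative 1 / G u) (at u within {0..t})"
        using dG[OF u] by (auto intro!: derivative_eq_intros)
      show "0 \<le> 1 / G u"
        using pos[of u] u by simp
    qed
    then show ?thesis by (simp add: x_def)
  qed
  define D where "D t = x t + 1 / \<nu> * l t - G t" for t
  have dD: "(D has_real_derivative 1 / x t - 1 / G t) (at t within {0..c})" if "t \<in> {0..c}" for t c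
    unfolding D_def using that \<nu>
    by (auto intro!: derivative_eq_intros dG[OF that] dx dl)
  have D0: "D 0 = 0"
    by (simp add: D_def x_def l_def)
  have D: "0 \<le> D t" if "0 \<le> t" for t
  proof -
    have "D 0 \<le> D t"
    proof (rule nonneg_derivative_within_imp_le[OF that dD])
      fix u assume "u \<in> {0..t}"
      then show "0 \<le> 1 / x u - 1 / G u"
        using lower[of u] x[of u] by (simp add: frac_le)
    qed
    then show ?thesis by (simp add: D0)
  qed
  show "G b - G 0 \<le> \<nu> * b + 1 / \<nu> * l b"
    using D[OF b] by (simp add: D_def x_def)
  \<comment> \<open>\<open>D' = (G - x) / (x G) \<le> l / (\<nu> x\<^sup>2)\<close>, and \<open>- (l + 1) / (\<nu>\<^sup>2 x)\<close> is a primitive of the right-hand side.\<close>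
  have "- ((l 0 + 1) / x 0) / \<nu>\<^sup>2 - D 0 \<le> - ((l b + 1) / x b) / \<nu>\<^sup>2 - D b"
  proof (rule nonneg_derivative_within_imp_le[OF b])
    fix t assume t: "t \<in> {0..b}"
    then have t0: "0 \<le> t" by simp
    have "((\<lambda>t. - ((l t + 1) / x t) / \<nu>\<^sup>2 - D t) has_real_derivative
        - (((\<nu> / x t + 0) * x t - (l t + 1) * \<nu>) / (x t * x t)) / \<nu>\<^sup>2 - (1 / x t - 1 / G t)) (at t within {0..b})"
      using x[OF t0]
      by (intro DERIV_diff DERIV_cdivide DERIV_minus DERIV_divide DERIV_add DERIV_const dl dx dD t t0) simp
    also have "- (((\<nu> / x t + 0) * x t - (l t + 1) * \<nu>) / (x t * x t)) / \<nu>\<^sup>2 - (1 / x t - 1 / G t)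
        = l t / (\<nu> * x t * x t) - (1 / x t - 1 / G t)"
      using x[OF t0] \<nu> by (simp add: field_simps power2_eq_square)
    finally show "((\<lambda>t. - ((l t + 1) / x t) / \<nu>\<^sup>2 - D t) has_real_derivative
        l t / (\<nu> * x t * x t) - (1 / x t - 1 / G t)) (at t within {0..b})" .
    have "1 / x t - 1 / G t = (G t - x t) / (x t * G t)"
      using x[OF t0] pos[OF t0] by (simp add: field_simps)
    \<comment> \<open>\<open>D t \<ge> 0\<close> bounds the numerator, and
      \<open>x t \<le> G t\<close> bounds the denominator from below.\<close>
    also have "\<dots> \<le> (1 / \<nu> * l t) / (x t * x t)"
      using D[OF t0] lower[OF t0] x[OF t0] l0[OF t0] \<nu>
      by (intro frac_le mult_left_mono) (auto simp: D_def)
    finally show "0 \<le> l t / (\<nu> * x t * x t) - (1 / x t - 1 / G t)"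
      by (simp add: mult.assoc)
  qed
  moreover have "0 \<le> (l b + 1) / x b / \<nu>\<^sup>2"
    using l0[OF b] x[OF b] by simp
  moreover have "(l 0 + 1) / x 0 / \<nu>\<^sup>2 = 1 / (\<nu>\<^sup>2 * G 0)"
    by (simp add: l_def x_def mult.commute)
  ultimately have "D b \<le> 1 / (\<nu>\<^sup>2 * G 0)"
    using D0 by simp
  then show "\<nu> * b + 1 / \<nu> * l b \<le> G b - G 0 + 1 / (\<nu>\<^sup>2 * G 0)"
    by (simp add: D_def x_def)
qed

lemma eventually_bounded_smallo_at_top:
  fixes f g :: "'a \<Rightarrow> real"
  assumes f: "\<forall>\<^sub>F t in F. \<bar>f t\<bar> \<le> K" and g: "filterlim g at_top F"
  shows "f \<in> o[F](g)"
proof (rule landau_o.smallI)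
  fix c :: real assume "0 < c"
  have "\<forall>\<^sub>F t in F. K / c \<le> g t" "\<forall>\<^sub>F t in F. 0 \<le> g t"
    using g by (auto simp: filterlim_at_top)
  with f show "\<forall>\<^sub>F t in F. norm (f t) \<le> c * norm (g t)"
    by eventually_elim (use \<open>0 < c\<close> in \<open>simp add: divide_simps mult.commute\<close>)
qed

section \<open>The two formulas for \<open>1 / \<Lambda>(R)\<close>\<close>

context markov_branching_process
begin

lemma gen_fun_compl_range:
  assumes "0 \<le> t" "0 \<le> s" "s < 1"
  shows "gen_fun_compl Pr Z t s \<in> {0<..1}"
  using gen_fun_less_1[OF assms] gen_fun_bounds(1)[of t s] assms by (simp add: gen_fun_compl_def)

text \<open>The backward equation and the form of \<open>inf_gf\<close> near \<open>1\<close> give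
  \<open>R' = - R \<Lambda>(R)\<close>; since \<open>R\<close> stays in \<open>{0<..1}\<close>, the
  chain rule above applies.\<close>

lemma inverse_rate_has_real_derivative:
  fixes \<Lambda> \<Lambda>' :: "real \<Rightarrow> real"
  assumes f: "\<And>y. y \<in> {0<..1} \<Longrightarrow> inf_gf S a (1 - y) = y * \<Lambda> y"
    and pos: "\<And>y. y \<in> {0<..1} \<Longrightarrow> 0 < \<Lambda> y"
    and d\<Lambda>: "\<And>y. y \<in> {0<..1} \<Longrightarrow> (\<Lambda> has_real_derivative \<Lambda>' y) (at y within {0<..1})"
    and s: "0 \<le> s" "s < 1" and t: "t \<in> {0..b}"
  defines "R \<equiv> \<lambda>u. gen_fun_compl Pr Z u s"
  shows "((\<lambda>u. 1 / \<Lambda> (R u)) has_real_derivative R t * \<Lambda>' (R t) / \<Lambda> (R t)) (at t within {0..b})"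
proof (rule has_real_derivative_inverse_comp)
  show range: "R u \<in> {0<..1}" if "u \<in> {0..b}" for u
    using gen_fun_compl_range[of u s] that s by (simp add: R_def)
  have "(R has_real_derivative 0 - inf_gf S a (gen_fun Pr Z t s)) (at t within {0..b})"
    unfolding R_def gen_fun_compl_def
    by (intro DERIV_diff DERIV_const gen_fun_has_real_derivative s t)
  also have "0 - inf_gf S a (gen_fun Pr Z t s) = - (R t * \<Lambda> (R t))"
    using f[OF range[OF t]] by (simp add: R_def gen_fun_compl_def)
  finally show "(R has_real_derivative - (R t * \<Lambda> (R t))) (at t within {0..b})" .
  show "(\<Lambda> has_real_derivative \<Lambda>' (R t)) (at (R t) within {0<..1})" "0 < \<Lambda> (R t)"
    using range[OF t] by (auto intro: d\<Lambda> pos)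
qed (rule t)

end

theorem lemma2:
  fixes S :: "nat set"
    and Pr :: "nat \<Rightarrow> 'w measure"
    and Z :: "real \<Rightarrow> 'w \<Rightarrow> nat"
    and a :: "nat \<Rightarrow> real"
    and \<nu> :: real
    and \<Lambda> \<Lambda>' L \<delta> :: "real \<Rightarrow> real"
    and R :: "real \<Rightarrow> real \<Rightarrow> real"
  defines "R \<equiv> gen_fun_compl Pr Z"
  assumes "critical_markov_branching_process S Pr Z a"
    and "0 < \<nu>" and "\<nu> < 1"
    and "\<And>y. y \<in> {0<..1} \<Longrightarrow> inf_gf S a (1 - y) = y * \<Lambda> y"
    and "\<And>y. y \<in> {0<..1} \<Longrightarrow> \<Lambda> y = y powr \<nu> * L (1 / y)"
    and "slowly_varying L"
    and "\<And>y. y \<in> {0<..1} \<Longrightarrow> (\<Lambda> has_real_derivative \<Lambda>' y) (at y within {0<..1})"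
    and "\<And>y. y \<in> {0<..1} \<Longrightarrow> y * \<Lambda>' y / \<Lambda> y = \<nu> + \<delta> y"
    and "continuous_on {0<..1} \<delta>"
    and "(\<delta> \<longlongrightarrow> 0) (at_right 0)"
  shows "(\<forall>s\<in>{0..<1}. \<forall>t\<ge>0.
            (\<lambda>u. \<delta> (R u s)) integrable_on {0..t} \<and>
            1 / \<Lambda> (R t s) - 1 / \<Lambda> (1 - s) = \<nu> * t + integral {0..t} (\<lambda>u. \<delta> (R u s)))
       \<and> ((\<forall>y\<in>{0<..1}. \<delta> y = \<Lambda> y) \<longrightarrow>
          (\<forall>s\<in>{0..<1}.
            (\<lambda>t. 1 / \<Lambda> (R t s) - 1 / \<Lambda> (1 - s)
                   - (\<nu> * t + 1 / \<nu> * ln (\<Lambda> (1 - s) * \<nu> * t + 1)))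
              \<in> o[at_top](\<lambda>t. ln (\<Lambda> (1 - s) * \<nu> * t + 1))))"
proof -
  interpret critical_markov_branching_process S Pr Z a
    by (rule assms(2))
  note f = assms(5) and d\<Lambda> = assms(8)
  have pos: "0 < \<Lambda> y" if "y \<in> {0<..1}" for y
    using assms(6)[OF that] assms(7) that by (simp add: slowly_varying_def)
  have range: "R t s \<in> {0<..1}" if "0 \<le> t" "s \<in> {0..<1}" for t s
    unfolding R_def using gen_fun_compl_range[of t s] that by simp
  have R0: "R 0 s = 1 - s" if "s \<in> {0..<1}" for s
    using gen_fun_0[of s] that by (simp add: R_def gen_fun_compl_def)
  have deriv: "((\<lambda>u. 1 / \<Lambda> (R u s)) has_real_derivative \<nu> + \<delta> (R t s)) (at t within {0..b})"
    if "s \<in> {0..<1}" "t \<in> {0..b}" for s t b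
    using inverse_rate_has_real_derivative[OF f pos d\<Lambda>, of s t b] assms(9)[OF range[of t s]] that
    by (simp add: R_def)
  have "((\<lambda>u. \<delta> (R u s)) has_integral 1 / \<Lambda> (R t s) - 1 / \<Lambda> (1 - s) - \<nu> * t) {0..t}"
    if s: "s \<in> {0..<1}" and t: "0 \<le> t" for s t
  proof -
    \<comment> \<open>The fundamental theorem delivers the existence of the integral together with
      its value, hence also the integrability claim.\<close>
    have "((\<lambda>u. \<nu> + \<delta> (R u s)) has_integral 1 / \<Lambda> (R t s) - 1 / \<Lambda> (R 0 s)) {0..t}"
      using deriv[OF s]
      by (intro fundamental_theorem_of_calculus t) (simp add: has_real_derivative_iff_has_vector_derivative)
    from has_integral_diff[OF this has_integral_const_real[of \<nu> 0 t]]
    show ?thesis using t by (simp add: R0[OF s] mult.commute)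
  qed
  then have integral: "\<forall>s\<in>{0..<1}. \<forall>t\<ge>0.
      (\<lambda>u. \<delta> (R u s)) integrable_on {0..t} \<and>
      1 / \<Lambda> (R t s) - 1 / \<Lambda> (1 - s) = \<nu> * t + integral {0..t} (\<lambda>u. \<delta> (R u s))"
    by (force simp: has_integral_iff)
  have "(\<lambda>t. 1 / \<Lambda> (R t s) - 1 / \<Lambda> (1 - s) - (\<nu> * t + 1 / \<nu> * ln (\<Lambda> (1 - s) * \<nu> * t + 1)))
      \<in> o[at_top](\<lambda>t. ln (\<Lambda> (1 - s) * \<nu> * t + 1))"
    if \<delta>: "\<forall>y\<in>{0<..1}. \<delta> y = \<Lambda> y" and s: "s \<in> {0..<1}" for s
  proof (rule eventually_bounded_smallo_at_top)
    define G where "G u = 1 / \<Lambda> (R u s)" for u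
    have G: "0 < G t" if "0 \<le> t" for t
      using pos[OF range[OF that s]] by (simp add: G_def)
    \<comment> \<open>Here \<open>\<delta> (R t s) = \<Lambda> (R t s) = 1 / G t\<close>, which
      makes the equation autonomous in \<open>G\<close>.\<close>
    have dG: "(G has_real_derivative \<nu> + 1 / G t) (at t within {0..b})" if "t \<in> {0..b}" for t b
      using deriv[OF s that] \<delta> range[of t s] s that by (simp add: G_def[abs_def])
    have G0: "G 0 = 1 / \<Lambda> (1 - s)"
      by (simp add: G_def R0[OF s])
    \<comment> \<open>As \<open>1 / G 0 = \<Lambda> (1 - s)\<close>, the two bounds place the
      remainder between \<open>- 1 / (\<nu>\<^sup>2 * G 0)\<close> and \<open>0\<close>.\<close>
    have "\<bar>G t - G 0 - (\<nu> * t + 1 / \<nu> * ln (\<Lambda> (1 - s) * \<nu> * t + 1))\<bar> \<le> 1 / (\<nu>\<^sup>2 * G 0)"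
      if "0 \<le> t" for t
      using logarithmic_correction_bounds[OF assms(3) G dG that] by (simp add: G0 abs_le_iff)
    then show "\<forall>\<^sub>F t in at_top.
        \<bar>1 / \<Lambda> (R t s) - 1 / \<Lambda> (1 - s) - (\<nu> * t + 1 / \<nu> * ln (\<Lambda> (1 - s) * \<nu> * t + 1))\<bar> \<le> 1 / (\<nu>\<^sup>2 * G 0)"
      by (intro eventually_mono[OF eventually_ge_at_top[of 0]]) (simp add: G_def R0[OF s])
    have "0 < \<Lambda> (1 - s) * \<nu>"
      using pos[of "1 - s"] s assms(3) by simp
    then show "filterlim (\<lambda>t. ln (\<Lambda> (1 - s) * \<nu> * t + 1)) at_top at_top"
      unfolding add.commute[of _ 1]
      by (intro filterlim_compose[OF ln_at_top] filterlim_tendsto_add_at_top[OF tendsto_const]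
            filterlim_tendsto_pos_mult_at_top[OF tendsto_const] filterlim_ident)
  qed
  with integral show ?thesis
    by blast
qed

end
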